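(* Let $H$ be a monoid. The following hold: (i) If $H$ is atomic, then every powerful atom of $H$ is a prime of $H$. (ii) If $H$ is cancellative and commutative, then every prime of $H$ is a powerful atom of $H$.
   Context: Let $H$ be a multiplicatively written monoid with group of units $H^\times$. For $x,y\in H$, $x\mid_H y$ means $y=uxv$ for some $u,v\in H$, and $x\simeq_H y$ means $x\in H^\times yH^\times$. An element $p\in H$ is prime (a prime of $H$) if $p\notin H^\times$ and, whenever $p\mid_H xy$ for some $x,y\in H$, then $p\mid_H x$ or $p\mid_H y$. $H$ is cancellative if $xz=yz$ or $zx=zy$ implies $x=y$. An atom of $H$ is an element $a \in H \setminus H^\times$ such that $a \ne xy$ for all $x,y \in H\setminus H^\times$; $\mathscr A(H)$ is the set of atoms. $H$ is atomic if every element of $H\setminus H^\times$ is a finite product of atoms. $\mathscr F(\mathscr A(H))$ is the free monoid on the set $\mathscr A(H)$, with operation $\ast$ (concatenation); $\pi_H:\mathscr F(\mathscr A(H))\to H$ is the monoid homomorphism with $\pi_H(a)=a$ for all $a\in\mathscr A(H)$. For $a\in\mathscr A(H)$, $\mathsf v_a^H:\mathscr F(\mathscr A(H))\to\mathbf N$ maps the empty word to $0$ and a word $a_1\ast\cdots\ast a_n$ of length $n\ge1$ to the number of indices $i\in\{1,\dots,n\}$ with $a_i\simeq_H a$. The atom $a$ is powerful if $\mathsf v_a^H(\mathfrak b)=\mathsf v_a^H(\mathfrak c)$ for all $\mathfrak b,\mathfrak c\in\mathscr F(\mathscr A(H))$ with $\pi_H(\mathfrak b)=\pi_H(\mathfrak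 c)$. *)

theory Defs
  imports "HOL-Algebra.Divisibility"
begin

text \<open>
  Divisibility, associatedness, primes and atoms are two-sided, since \<open>H\<close> need not be commutative.
  The constants \<^const>\<open>factor\<close>, \<^const>\<open>associated\<close>, \<^const>\<open>prime\<close> and \<^const>\<open>irreducible\<close> of
  \<^theory>\<open>HOL-Algebra.Divisibility\<close> are built on the one-sided relation \<open>b \<in> a H\<close> and therefore
  are not used.
\<close>

definition two_sided_dvd :: "('a, 'm) monoid_scheme \<Rightarrow> 'a \<Rightarrow> 'a \<Rightarrow> bool" where
  "two_sided_dvd H x y \<longleftrightarrow> (\<exists>u\<in>carrier H. \<exists>v\<in>carrier H. y = u \<otimes>\<^bsub>H\<^esub> x \<otimes>\<^bsub>H\<^esub> v)"

definition two_sided_assoc :: "('a, 'm) monoid_scheme \<Rightarrow> 'a \<Rightarrow> 'a \<Rightarrow> bool" where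
  "two_sided_assoc H x y \<longleftrightarrow> (\<exists>u\<in>Units H. \<exists>v\<in>Units H. x = u \<otimes>\<^bsub>H\<^esub> y \<otimes>\<^bsub>H\<^esub> v)"

definition primes_of :: "('a, 'm) monoid_scheme \<Rightarrow> 'a set" where
  "primes_of H = {p \<in> carrier H - Units H. \<forall>x\<in>carrier H. \<forall>y\<in>carrier H.
     two_sided_dvd H p (x \<otimes>\<^bsub>H\<^esub> y) \<longrightarrow> two_sided_dvd H p x \<or> two_sided_dvd H p y}"

definition atoms_of :: "('a, 'm) monoid_scheme \<Rightarrow> 'a set" where
  "atoms_of H = {a \<in> carrier H - Units H.
     \<forall>x\<in>carrier H - Units H. \<forall>y\<in>carrier H - Units H. a \<noteq> x \<otimes>\<^bsub>H\<^esub> y}"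

text \<open>
  The free monoid on \<open>\<A>(H)\<close> is \<open>lists (atoms_of H)\<close> under concatenation. The next function is the
  homomorphism \<open>\<pi>\<^sub>H\<close> (defined on all lists): a word is sent to its product in \<open>H\<close>,
  the empty word to the identity.
\<close>

definition word_prod :: "('a, 'm) monoid_scheme \<Rightarrow> 'a list \<Rightarrow> 'a" where
  "word_prod H w = foldr (\<otimes>\<^bsub>H\<^esub>) w \<one>\<^bsub>H\<^esub>"

definition atomic_monoid :: "('a, 'm) monoid_scheme \<Rightarrow> bool" where
  "atomic_monoid H \<longleftrightarrow>
     (\<forall>x\<in>carrier H - Units H. \<exists>w\<in>lists (atoms_of H). x = word_prod H w)"

definition word_val :: "('a, 'm) monoid_scheme \<Rightarrow> 'a \<Rightarrow> 'a list \<Rightarrow> nat" where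
  "word_val H a w = card {i. i < length w \<and> two_sided_assoc H (w ! i) a}"

definition powerful_atoms_of :: "('a, 'm) monoid_scheme \<Rightarrow> 'a set" where
  "powerful_atoms_of H = {a \<in> atoms_of H.
     \<forall>b\<in>lists (atoms_of H). \<forall>c\<in>lists (atoms_of H).
       word_prod H b = word_prod H c \<longrightarrow> word_val H a b = word_val H a c}"

end

theory Submission imports Defs begin

text \<open>
  A multiple \<open>u a v\<close> of an atom \<open>a\<close> of an atomic monoid always has a factorization into atoms that
  contains an associate of \<open>a\<close>: factor \<open>u\<close> and \<open>v\<close> if they are non-units, and absorb them
  into \<open>a\<close> if they are units. If \<open>a\<close> is powerful, then \<^emph>\<open>every\<close> factorization of a multiple
  of \<open>a\<close> therefore contains an associate of \<open>a\<close>. Primality follows: when \<open>a\<close> divides the product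
  \<open>x y\<close> of two non-units, concatenate a factorization of \<open>x\<close> with one of \<open>y\<close>, and an associate
  of \<open>a\<close> must occur in one of the two parts. If instead \<open>x\<close> or \<open>y\<close> is a unit, it can be moved to the
  other side of \<open>x y = u a v\<close>, so that \<open>a\<close> divides the other factor.

  In a commutative cancellative monoid, cancellation shows that a prime \<open>p\<close> is an
  atom whose only atomic multiples are its associates. In the product of a word one can
  then collect the associates of \<open>p\<close>: the product is \<open>p\<^sup>n z\<close>, where \<open>n\<close> is the
  number of letters associated to \<open>p\<close> and \<open>p\<close> does not divide \<open>z\<close>. Cancellation makes the exponent \<open>n\<close>
  depend only on the product, so \<open>p\<close> is powerful.
\<close>

section \<open>Words and units\<close>

lemma word_val_filter:
  "word_val H a w = length (filter (\<lambda>x. two_sided_assoc H x a) w)"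
  by (simp add: word_val_def length_filter_conv_card)

lemma word_val_simps [simp]:
  "word_val H a [] = 0"
  "word_val H a (x # w) = (if two_sided_assoc H x a then 1 else 0) + word_val H a w"
  "word_val H a (v @ w) = word_val H a v + word_val H a w"
  by (simp_all add: word_val_filter)

lemma word_prod_simps [simp]:
  "word_prod H [] = \<one>\<^bsub>H\<^esub>"
  "word_prod H (x # w) = x \<otimes>\<^bsub>H\<^esub> word_prod H w"
  by (simp_all add: word_prod_def)

lemma atoms_of_carrier: "a \<in> atoms_of H \<Longrightarrow> a \<in> carrier H"
  by (simp add: atoms_of_def)

context monoid
begin

lemma word_prod_closed [simp, intro]:
  "w \<in> lists (atoms_of G) \<Longrightarrow> word_prod G w \<in> carrier G"
  by (induction w) (auto simp: atoms_of_carrier)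

lemma word_prod_append:
  "\<lbrakk>v \<in> lists (atoms_of G); w \<in> lists (atoms_of G)\<rbrakk> \<Longrightarrow>
     word_prod G (v @ w) = word_prod G v \<otimes> word_prod G w"
  by (induction v) (auto simp: atoms_of_carrier m_assoc)

lemma two_sided_assoc_refl: "x \<in> carrier G \<Longrightarrow> two_sided_assoc G x x"
  unfolding two_sided_assoc_def by (metis Units_one_closed l_one r_one)

lemma two_sided_assoc_imp_dvd:
  "two_sided_assoc G x a \<Longrightarrow> two_sided_dvd G a x"
  unfolding two_sided_assoc_def two_sided_dvd_def using Units_closed by blast

lemma two_sided_dvd_trans:
  assumes "two_sided_dvd G a b" "two_sided_dvd G b c" "a \<in> carrier G"
  shows "two_sided_dvd G a c"
proof -
  obtain u v where uv: "u \<in> carrier G" "v \<in> carrier G" "b = u \<otimes> a \<otimes> v"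
    using assms(1) by (auto simp: two_sided_dvd_def)
  obtain s t where st: "s \<in> carrier G" "t \<in> carrier G" "c = s \<otimes> b \<otimes> t"
    using assms(2) by (auto simp: two_sided_dvd_def)
  have "c = (s \<otimes> u) \<otimes> a \<otimes> (v \<otimes> t)"
    using uv st assms(3) by (simp add: m_assoc)
  then show ?thesis
    unfolding two_sided_dvd_def using uv st by blast
qed

lemma Units_mult_left_iff:
  assumes "u \<in> Units G" "x \<in> carrier G"
  shows "u \<otimes> x \<in> Units G \<longleftrightarrow> x \<in> Units G"
proof
  assume "u \<otimes> x \<in> Units G"
  then have "inv u \<otimes> (u \<otimes> x) \<in> Units G" using assms by blast
  then show "x \<in> Units G"
    using assms by (metis Units_closed Units_inv_closed Units_l_inv l_one m_assoc)
qed (use assms in blast)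

lemma Units_mult_right_iff:
  assumes "u \<in> Units G" "x \<in> carrier G"
  shows "x \<otimes> u \<in> Units G \<longleftrightarrow> x \<in> Units G"
proof
  assume "x \<otimes> u \<in> Units G"
  then have "(x \<otimes> u) \<otimes> inv u \<in> Units G" using assms by blast
  then show "x \<in> Units G"
    using assms by (metis Units_closed Units_inv_closed Units_r_inv r_one m_assoc)
qed (use assms in blast)

lemma unit_mult_atom:
  assumes "u \<in> Units G" "a \<in> atoms_of G"
  shows "u \<otimes> a \<in> atoms_of G"
proof -
  have a: "a \<in> carrier G" "a \<notin> Units G" using assms by (auto simp: atoms_of_def)
  have False if xy: "x \<in> carrier G - Units G" "y \<in> carrier G - Units G" "u \<otimes> a = x \<otimes> y" for x y
  proof -
    have "a = inv u \<otimes> (u \<otimes> a)"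
      using a assms(1) by (metis Units_closed Units_inv_closed Units_l_inv l_one m_assoc)
    also have "\<dots> = (inv u \<otimes> x) \<otimes> y"
      using xy assms(1) by (simp add: m_assoc)
    finally have "a = (inv u \<otimes> x) \<otimes> y" .
    moreover have "inv u \<otimes> x \<in> carrier G - Units G"
      using xy assms(1) Units_mult_left_iff by auto
    ultimately show False using assms(2) xy by (auto simp: atoms_of_def)
  qed
  then show ?thesis
    using a assms(1) Units_mult_left_iff by (auto simp: atoms_of_def)
qed

lemma atom_mult_unit:
  assumes "u \<in> Units G" "a \<in> atoms_of G"
  shows "a \<otimes> u \<in> atoms_of G"
proof -
  have a: "a \<in> carrier G" "a \<notin> Units G" using assms by (auto simp: atoms_of_def)
  have False if xy: "x \<in> carrier G - Units G" "y \<in> carrier G - Units G" "a \<otimes> u = x \<otimes> y" for x y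
  proof -
    have "a = (a \<otimes> u) \<otimes> inv u"
      using a assms(1) by (metis Units_closed Units_inv_closed Units_r_inv r_one m_assoc)
    also have "\<dots> = x \<otimes> (y \<otimes> inv u)"
      using xy assms(1) by (simp add: m_assoc)
    finally have "a = x \<otimes> (y \<otimes> inv u)" .
    moreover have "y \<otimes> inv u \<in> carrier G - Units G"
      using xy assms(1) Units_mult_right_iff by auto
    ultimately show False using assms(2) xy by (auto simp: atoms_of_def)
  qed
  then show ?thesis
    using a assms(1) Units_mult_right_iff by (auto simp: atoms_of_def)
qed

section \<open>Powerful atoms of an atomic monoid\<close>

text \<open>
  In an atomic monoid every element is \<open>e z\<close> and also \<open>z e\<close>, where \<open>e\<close> is a unit and \<open>z\<close> is a product
  of atoms: one of the two factors can be taken to be the identity. So the cofactors of \<open>a\<close>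
  contribute letters outside \<open>a\<close> and units that turn \<open>a\<close> into an associated atom.
\<close>

lemma multiple_of_atom_has_word:
  assumes atomic: "atomic_monoid G" and a: "a \<in> atoms_of G"
    and dvd: "two_sided_dvd G a z"
  shows "\<exists>w\<in>lists (atoms_of G). word_prod G w = z \<and> word_val G a w > 0"
proof -
  have split: "\<exists>e\<in>Units G. \<exists>w\<in>lists (atoms_of G). x = word_prod G w \<otimes> e \<and> x = e \<otimes> word_prod G w"
    if x: "x \<in> carrier G" for x
  proof (cases "x \<in> Units G")
    case True
    then show ?thesis using x by (intro bexI[of _ x] bexI[of _ "[]"]) auto
  next
    case False
    then obtain w where "w \<in> lists (atoms_of G)" "x = word_prod G w"
      using atomic x by (auto simp: atomic_monoid_def)
    then show ?thesis by (intro bexI[of _ \<one>] bexI[of _ w]) auto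
  qed
  obtain u v where uv: "u \<in> carrier G" "v \<in> carrier G" "z = u \<otimes> a \<otimes> v"
    using dvd by (auto simp: two_sided_dvd_def)
  obtain e b where e: "e \<in> Units G" "b \<in> lists (atoms_of G)" "u = word_prod G b \<otimes> e"
    using split[OF uv(1)] by blast
  obtain f c where f: "f \<in> Units G" "c \<in> lists (atoms_of G)" "v = f \<otimes> word_prod G c"
    using split[OF uv(2)] by blast
  let ?a = "e \<otimes> a \<otimes> f"
  have atom: "?a \<in> atoms_of G"
    using unit_mult_atom atom_mult_unit e f a by blast
  have assoc: "two_sided_assoc G ?a a"
    using e f by (auto simp: two_sided_assoc_def)
  have "word_prod G (b @ ?a # c) = word_prod G b \<otimes> (?a \<otimes> word_prod G c)"
    using e f atom by (simp add: word_prod_append)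
  also have "\<dots> = z"
    using e f uv(3) atoms_of_carrier[OF a] Units_closed[OF e(1)] Units_closed[OF f(1)]
      word_prod_closed[OF e(2)] word_prod_closed[OF f(2)] by (simp add: m_assoc)
  finally show ?thesis
    using e f atom assoc by (intro bexI[of _ "b @ ?a # c"]) auto
qed

text \<open>
  Being powerful transfers the occurrence of an associate of \<open>a\<close> from one well-chosen
  factorization of a multiple of \<open>a\<close> to all of them.
\<close>

lemma powerful_atom_occurs_in_multiple:
  assumes "atomic_monoid G" "a \<in> powerful_atoms_of G"
    and "w \<in> lists (atoms_of G)" "two_sided_dvd G a (word_prod G w)"
  shows "word_val G a w > 0"
proof -
  have a: "a \<in> atoms_of G" using assms(2) by (simp add: powerful_atoms_of_def)
  obtain b where b: "b \<in> lists (atoms_of G)" "word_prod G b = word_prod G w" "word_val G a b > 0"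
    using multiple_of_atom_has_word[OF assms(1) a assms(4)] by blast
  have "word_val G a b = word_val G a w"
    using assms(2,3) b(1,2) unfolding powerful_atoms_of_def by blast
  then show ?thesis using b(3) by simp
qed

lemma dvd_word_prod_if_occurs:
  assumes "w \<in> lists (atoms_of G)" "word_val G a w > 0" "a \<in> carrier G"
  shows "two_sided_dvd G a (word_prod G w)"
  using assms
proof (induction w)
  case (Cons x w)
  have x: "x \<in> carrier G" "w \<in> lists (atoms_of G)"
    using Cons.hyps by (auto simp: atoms_of_carrier)
  show ?case
  proof (cases "two_sided_assoc G x a")
    case True
    have "two_sided_dvd G x (word_prod G (x # w))"
      unfolding two_sided_dvd_def using x
      by (intro bexI[of _ \<one>] bexI[of _ "word_prod G w"]) auto
    then show ?thesis
      using two_sided_assoc_imp_dvd[OF True] two_sided_dvd_trans assms(3) by blast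
  next
    case False
    have "two_sided_dvd G (word_prod G w) (word_prod G (x # w))"
      unfolding two_sided_dvd_def using x
      by (intro bexI[of _ x] bexI[of _ \<one>]) auto
    moreover have "two_sided_dvd G a (word_prod G w)"
      using Cons x False by auto
    ultimately show ?thesis using two_sided_dvd_trans assms(3) by blast
  qed
qed simp

text \<open>
  Since \<open>u y = z\<close> gives \<open>y = u\<^sup>-\<^sup>1 z\<close> for a unit \<open>u\<close>, unit factors do not affect the multiples of
  an element.
\<close>

lemma two_sided_dvd_unit_mult:
  assumes "u \<in> Units G" "y \<in> carrier G" "a \<in> carrier G"
  shows "two_sided_dvd G a (u \<otimes> y) \<Longrightarrow> two_sided_dvd G a y"
    and "two_sided_dvd G a (y \<otimes> u) \<Longrightarrow> two_sided_dvd G a y"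
proof -
  have u: "u \<in> carrier G" using assms by auto
  have "y = inv u \<otimes> (u \<otimes> y) \<otimes> \<one>"
    using assms u by (metis Units_inv_closed Units_l_inv l_one m_assoc r_one)
  then have "two_sided_dvd G (u \<otimes> y) y"
    unfolding two_sided_dvd_def using assms by blast
  then show "two_sided_dvd G a (u \<otimes> y) \<Longrightarrow> two_sided_dvd G a y"
    using two_sided_dvd_trans assms by blast
  have "y = \<one> \<otimes> (y \<otimes> u) \<otimes> inv u"
    using assms u by (metis Units_inv_closed Units_r_inv l_one m_assoc m_closed r_one)
  then have "two_sided_dvd G (y \<otimes> u) y"
    unfolding two_sided_dvd_def using assms by blast
  then show "two_sided_dvd G a (y \<otimes> u) \<Longrightarrow> two_sided_dvd G a y"
    using two_sided_dvd_trans assms by blast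
qed

lemma powerful_atom_prime:
  assumes atomic: "atomic_monoid G" and a: "a \<in> powerful_atoms_of G"
  shows "a \<in> primes_of G"
proof -
  have aG: "a \<in> carrier G" "a \<notin> Units G"
    using a by (auto simp: powerful_atoms_of_def atoms_of_def)
  have "two_sided_dvd G a x \<or> two_sided_dvd G a y"
    if x: "x \<in> carrier G" and y: "y \<in> carrier G" and d: "two_sided_dvd G a (x \<otimes> y)" for x y
  proof (cases "x \<in> Units G \<or> y \<in> Units G")
    case True
    then show ?thesis using two_sided_dvd_unit_mult x y d aG by blast
  next
    case False
    then obtain b c where bc: "b \<in> lists (atoms_of G)" "x = word_prod G b"
        "c \<in> lists (atoms_of G)" "y = word_prod G c"
      using atomic x y unfolding atomic_monoid_def by blast
    then have "word_val G a (b @ c) > 0"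
      using d by (intro powerful_atom_occurs_in_multiple[OF atomic a]) (auto simp: word_prod_append)
    then show ?thesis using dvd_word_prod_if_occurs bc aG by auto
  qed
  then show ?thesis using aG by (auto simp: primes_of_def)
qed

end

section \<open>Primes of a commutative cancellative monoid\<close>

lemma (in comm_monoid) two_sided_dvd_iff:
  assumes "p \<in> carrier G"
  shows "two_sided_dvd G p x \<longleftrightarrow> (\<exists>s\<in>carrier G. x = p \<otimes> s)"
proof
  assume "two_sided_dvd G p x"
  then obtain u v where uv: "u \<in> carrier G" "v \<in> carrier G" "x = u \<otimes> p \<otimes> v"
    by (auto simp: two_sided_dvd_def)
  then have "x = p \<otimes> (u \<otimes> v)" using assms by (simp add: m_ac)
  then show "\<exists>s\<in>carrier G. x = p \<otimes> s" using uv by blast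
next
  assume "\<exists>s\<in>carrier G. x = p \<otimes> s"
  then obtain s where "s \<in> carrier G" "x = \<one> \<otimes> p \<otimes> s" using assms by auto
  then show "two_sided_dvd G p x" unfolding two_sided_dvd_def by blast
qed

locale comm_cancel_monoid = comm_monoid G + monoid_cancel G for G (structure)
begin

text \<open>
  Substituting \<open>x = p s\<close> into \<open>p = x y\<close> gives \<open>p = p s y\<close>, and cancelling \<open>p\<close> makes \<open>s\<close> an inverse
  of \<open>y\<close>. For a prime \<open>p = x y\<close>, one of \<open>x\<close> and \<open>y\<close> is a multiple of \<open>p\<close>, so the other is a unit.
\<close>

lemma cofactor_unit_if_dvd_factor:
  assumes "p \<in> carrier G" "x \<in> carrier G" "y \<in> carrier G" "p = x \<otimes> y"
    and "two_sided_dvd G p x"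
  shows "y \<in> Units G"
proof -
  obtain s where s: "s \<in> carrier G" "x = p \<otimes> s"
    using assms two_sided_dvd_iff by blast
  then have "p \<otimes> (s \<otimes> y) = p \<otimes> \<one>"
    using assms by (metis m_assoc r_one)
  then have "s \<otimes> y = \<one>" using s assms by (metis l_cancel m_closed one_closed)
  then show ?thesis using s assms m_comm unfolding Units_def by auto
qed

lemma prime_is_atom:
  assumes "p \<in> primes_of G"
  shows "p \<in> atoms_of G"
proof -
  have p: "p \<in> carrier G" "p \<notin> Units G" using assms by (auto simp: primes_of_def)
  have False if xy: "x \<in> carrier G - Units G" "y \<in> carrier G - Units G" "p = x \<otimes> y" for x y
  proof -
    have "two_sided_dvd G p (x \<otimes> y)"
      using two_sided_dvd_iff p xy by (metis one_closed r_one)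
    then have "two_sided_dvd G p x \<or> two_sided_dvd G p y"
      using assms xy by (auto simp: primes_of_def)
    moreover have "p = y \<otimes> x" using xy m_comm by auto
    ultimately show False using cofactor_unit_if_dvd_factor p xy by blast
  qed
  then show ?thesis using p by (auto simp: atoms_of_def)
qed

lemma atom_multiple_of_prime_assoc:
  assumes "p \<in> primes_of G" "c \<in> atoms_of G" "two_sided_dvd G p c"
  shows "two_sided_assoc G c p"
proof -
  have p: "p \<in> carrier G - Units G" using assms by (auto simp: primes_of_def)
  then obtain s where s: "s \<in> carrier G" "c = p \<otimes> s"
    using assms(3) two_sided_dvd_iff by blast
  then have "s \<in> Units G" using assms(2) p by (auto simp: atoms_of_def)
  moreover have "c = \<one> \<otimes> p \<otimes> s" using s p by simp
  ultimately show ?thesis unfolding two_sided_assoc_def by blast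
qed

text \<open>
  This identifies the number of letters associated to \<open>p\<close> with the \<open>p\<close>-adic valuation of the
  product. The letters not associated to \<open>p\<close> are not divisible by \<open>p\<close>, and hence neither is their
  product, by primality.
\<close>

lemma word_prod_prime_power:
  assumes p: "p \<in> primes_of G" and "w \<in> lists (atoms_of G)"
  shows "\<exists>z\<in>carrier G. \<not> two_sided_dvd G p z \<and> word_prod G w = p [^] word_val G p w \<otimes> z"
  using assms(2)
proof (induction w)
  have pG: "p \<in> carrier G" "p \<notin> Units G" using p by (auto simp: primes_of_def)
  case Nil
  have "\<not> two_sided_dvd G p \<one>"
    using pG two_sided_dvd_iff m_comm unfolding Units_def by force
  then show ?case by auto
next
  have pG: "p \<in> carrier G" "p \<notin> Units G" using p by (auto simp: primes_of_def)
  have prime: "\<not> two_sided_dvd G p (x \<otimes> y)"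
    if "\<not> two_sided_dvd G p x" "\<not> two_sided_dvd G p y" "x \<in> carrier G" "y \<in> carrier G" for x y
    using that p by (auto simp: primes_of_def)
  case (Cons c w)
  then obtain z where z: "z \<in> carrier G" "\<not> two_sided_dvd G p z"
      "word_prod G w = p [^] word_val G p w \<otimes> z"
    by auto
  have c: "c \<in> carrier G" "c \<in> atoms_of G" using Cons.hyps by (auto simp: atoms_of_carrier)
  show ?case
  proof (cases "two_sided_assoc G c p")
    case True
    then obtain u v where uv: "u \<in> Units G" "v \<in> Units G" "c = u \<otimes> p \<otimes> v"
      by (auto simp: two_sided_assoc_def)
    have "\<not> two_sided_dvd G p (u \<otimes> v \<otimes> z)"
      using two_sided_dvd_unit_mult(1)[of "u \<otimes> v" z p] uv z pG by auto
    moreover have "word_prod G (c # w) = p [^] word_val G p (c # w) \<otimes> (u \<otimes> v \<otimes> z)"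
      using True uv z pG by (simp add: m_ac Units_closed)
    ultimately show ?thesis using uv z by (auto simp del: word_prod_simps)
  next
    case False
    then have "\<not> two_sided_dvd G p (c \<otimes> z)"
      using atom_multiple_of_prime_assoc p c z by (intro prime) auto
    moreover have "word_prod G (c # w) = p [^] word_val G p (c # w) \<otimes> (c \<otimes> z)"
      using False z c pG by (simp add: m_ac)
    ultimately show ?thesis using c z by blast
  qed
qed

text \<open>
  If \<open>n\<close> were larger than \<open>m\<close>, cancelling \<open>p\<^sup>m\<close> would leave a factor \<open>p\<close> on the right, which would
  then divide \<open>y\<close>.
\<close>

lemma prime_power_exponent_le:
  assumes "p \<in> carrier G" "y \<in> carrier G" "z \<in> carrier G" "\<not> two_sided_dvd G p y"
    and eq: "p [^] m \<otimes> y = p [^] (n::nat) \<otimes> z"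
  shows "n \<le> m"
proof (rule ccontr)
  assume "\<not> n \<le> m"
  then obtain k where "n = m + Suc k"
    by (metis add_Suc_right less_iff_Suc_add not_le)
  then have "p [^] n = p [^] m \<otimes> (p \<otimes> p [^] k)"
    using assms by (simp add: nat_pow_mult [symmetric] m_ac)
  then have "p [^] m \<otimes> y = p [^] m \<otimes> (p \<otimes> (p [^] k \<otimes> z))"
    using assms by (simp add: m_assoc)
  then have "y = p \<otimes> (p [^] k \<otimes> z)"
    using assms(1-3) by (metis l_cancel m_closed nat_pow_closed)
  then show False using assms two_sided_dvd_iff by blast
qed

lemma prime_powerful:
  assumes p: "p \<in> primes_of G"
  shows "p \<in> powerful_atoms_of G"
proof -
  have pG: "p \<in> carrier G" using p by (auto simp: primes_of_def)
  have "word_val G p b = word_val G p c"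
    if bc: "b \<in> lists (atoms_of G)" "c \<in> lists (atoms_of G)" "word_prod G b = word_prod G c" for b c
  proof -
    obtain y where y: "y \<in> carrier G" "\<not> two_sided_dvd G p y"
        "word_prod G b = p [^] word_val G p b \<otimes> y"
      using word_prod_prime_power[OF p bc(1)] by blast
    obtain z where z: "z \<in> carrier G" "\<not> two_sided_dvd G p z"
        "word_prod G c = p [^] word_val G p c \<otimes> z"
      using word_prod_prime_power[OF p bc(2)] by blast
    show ?thesis
    proof (rule le_antisym)
      show "word_val G p b \<le> word_val G p c"
        by (rule prime_power_exponent_le[OF pG z(1) y(1) z(2)])
          (simp only: y(3)[symmetric] z(3)[symmetric] bc(3))
      show "word_val G p c \<le> word_val G p b"
        by (rule prime_power_exponent_le[OF pG y(1) z(1) y(2)])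
          (simp only: y(3)[symmetric] z(3)[symmetric] bc(3))
    qed
  qed
  then show ?thesis using prime_is_atom[OF p] unfolding powerful_atoms_of_def by blast
qed

end

theorem proposition5p8:
  fixes H :: "('a, 'm) monoid_scheme"
  assumes "monoid H"
  shows "(atomic_monoid H \<longrightarrow> powerful_atoms_of H \<subseteq> primes_of H) \<and>
         (monoid_cancel H \<and> comm_monoid H \<longrightarrow> primes_of H \<subseteq> powerful_atoms_of H)"
proof (intro conjI impI subsetI)
  fix a assume "atomic_monoid H" "a \<in> powerful_atoms_of H"
  then show "a \<in> primes_of H" by (rule monoid.powerful_atom_prime[OF assms])
next
  fix p assume "monoid_cancel H \<and> comm_monoid H" and p: "p \<in> primes_of H"
  then have "comm_cancel_monoid H" by (intro comm_cancel_monoid.intro) blast+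
  then show "p \<in> powerful_atoms_of H" using p by (rule comm_cancel_monoid.prime_powerful)
qed

end
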